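(* Let $(\Omega,\mathcal{F},\mu)$ be a probability space and $\mathcal{F}_1,\dots,\mathcal{F}_n$ be sub-$\sigma$-algebras of $\mathcal{F}$. If there exists a number $\alpha>0$ such that $$\mu(A_1\cap\dots\cap A_n)\geqslant\alpha\,\mu(A_1)\cdots\mu(A_n)$$ for arbitrary $A_1\in\mathcal{F}_1,\dots,A_n\in\mathcal{F}_n$, then the collection of sub-$\sigma$-algebras $\mathcal{F}_1,\dots,\mathcal{F}_n$ possesses the IMP.
   Context: Random variables take values in a fixed base field $\mathbb{K}$, $\mathbb{K}=\mathbb{R}$ or $\mathbb{C}$; $E$ denotes expectation. The collection $\mathcal{F}_1,\dots,\mathcal{F}_n$ possesses the inverse marginal property (IMP) if for arbitrary random variables $\xi_1,\dots,\xi_n$ such that $\xi_k$ is $\mathcal{F}_k$-measurable and $E|\xi_k|^2<\infty$ for $k=1,\dots,n$, and $E\xi_1=E\xi_2=\dots=E\xi_n$, there exists a random variable $\xi$ with $E|\xi|^2<\infty$ and $E(\xi|\mathcal{F}_k)=\xi_k$ (a.s.) for all $k=1,\dots,n$. *)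

theory Defs
  imports "HOL-Probability.Probability"
begin

text \<open>Conditional expectation of a complex-valued integrable random variable. The library only
  provides it for real-valued functions; the two lemmas after the definition show that it has the
  usual defining properties.\<close>

definition complex_cond_exp ::
  "'a measure \<Rightarrow> 'a measure \<Rightarrow> ('a \<Rightarrow> complex) \<Rightarrow> 'a \<Rightarrow> complex" where
  "complex_cond_exp M F f =
     (\<lambda>x. Complex (real_cond_exp M F (\<lambda>y. Re (f y)) x) (real_cond_exp M F (\<lambda>y. Im (f y)) x))"

lemma borel_measurable_complex_cond_exp:
  "complex_cond_exp M F f \<in> borel_measurable F"
  unfolding complex_cond_exp_def
  by (simp add: borel_measurable_complex_iff)

lemma complex_cond_exp_set_integral:
  assumes "prob_space M" "subalgebra M F" "integrable M f" "A \<in> sets F"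
  shows "set_integrable M A (complex_cond_exp M F f)"
    and "(LINT x:A|M. complex_cond_exp M F f x) = (LINT x:A|M. f x)"
proof -
  interpret prob_space M by fact
  interpret finite_measure_subalgebra M F
    by standard (rule assms(2))
  have A: "A \<in> sets M"
    using assms(2,4) by (auto simp: subalgebra_def)
  have iR: "integrable M (\<lambda>x. Re (f x))" and iI: "integrable M (\<lambda>x. Im (f x))"
    using assms(3) by auto
  have i: "integrable M (complex_cond_exp M F f)"
    using real_cond_exp_int(1)[OF iR] real_cond_exp_int(1)[OF iI]
    by (simp add: complex_cond_exp_def Complex_eq)
  show si: "set_integrable M A (complex_cond_exp M F f)"
    using i A by (simp add: set_integrable_def integrable_mult_indicator)
  have sf: "set_integrable M A f"
    using assms(3) A by (simp add: set_integrable_def integrable_mult_indicator)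
  have eR: "(LINT x:A|M. Re (complex_cond_exp M F f x)) = (LINT x:A|M. Re (f x))"
    and eI: "(LINT x:A|M. Im (complex_cond_exp M F f x)) = (LINT x:A|M. Im (f x))"
    using real_cond_exp_intA[OF iR assms(4)] real_cond_exp_intA[OF iI assms(4)]
    by (simp_all add: complex_cond_exp_def)
  show "(LINT x:A|M. complex_cond_exp M F f x) = (LINT x:A|M. f x)"
    using si sf eR eI
    by (simp add: complex_eq_iff set_lebesgue_integral_def set_integrable_def
        integral_Re[symmetric] integral_Im[symmetric])
qed

text \<open>The inverse marginal property of \<open>F 1, \<dots>, F n\<close>, with the conditional expectation operator of
  the base field as the parameter \<open>ce\<close>. A sub-sigma-algebra is represented by a measure space
  \<open>F k\<close> with \<open>subalgebra M (F k)\<close>; only its space and its measurable sets matter.\<close>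

definition imp_wrt ::
  "('a measure \<Rightarrow> 'a measure \<Rightarrow> ('a \<Rightarrow> 'k::{banach, second_countable_topology}) \<Rightarrow> 'a \<Rightarrow> 'k)
     \<Rightarrow> 'a measure \<Rightarrow> nat \<Rightarrow> (nat \<Rightarrow> 'a measure) \<Rightarrow> bool"
  where
  "imp_wrt ce M n F \<longleftrightarrow>
     (\<forall>\<xi> :: nat \<Rightarrow> 'a \<Rightarrow> 'k.
        (\<forall>k\<in>{1..n}. \<xi> k \<in> borel_measurable (F k) \<and> integrable M (\<lambda>x. (norm (\<xi> k x))\<^sup>2)) \<and>
        (\<forall>i\<in>{1..n}. \<forall>j\<in>{1..n}. (LINT x|M. \<xi> i x) = (LINT x|M. \<xi> j x))
        \<longrightarrow> (\<exists>\<eta> :: 'a \<Rightarrow> 'k. \<eta> \<in> borel_measurable M \<and> integrable M (\<lambda>x. (norm (\<eta> x))\<^sup>2) \<and>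
              (\<forall>k\<in>{1..n}. AE x in M. ce M (F k) \<eta> x = \<xi> k x)))"

definition IMP_real :: "'a measure \<Rightarrow> nat \<Rightarrow> (nat \<Rightarrow> 'a measure) \<Rightarrow> bool" where
  "IMP_real = imp_wrt real_cond_exp"

definition IMP_complex :: "'a measure \<Rightarrow> nat \<Rightarrow> (nat \<Rightarrow> 'a measure) \<Rightarrow> bool" where
  "IMP_complex = imp_wrt complex_cond_exp"

end

theory Submission
  imports Defs
begin

text \<open>
  Replacing \<open>\<xi> k\<close> by its real and imaginary parts, which conditional expectation treats separately,
  reduces the complex field to the real one. For real variables the proof has two ingredients.

  \<^emph>\<open>Centred variables of the different sigma-algebras are uniformly linearly independent in
  \<open>L\<^sup>2\<close>\<close> (\<open>sum_square_ge\<close>): if \<open>f k\<close> is measurable for \<open>F k\<close>, square integrable and centred, then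
  \<open>E (\<Sum>k. f k)\<^sup>2 \<ge> \<alpha> * (\<Sum>k. E (f k)\<^sup>2)\<close>. The hypothesis says that the joint law of the \<open>f k\<close> is at
  least \<open>\<alpha>\<close> times the product of their laws. Integrating the nonnegative function
  \<open>(\<Sum>k. y k)\<^sup>2\<close> against both, the product law gives the variance of a sum of independent centred
  variables, which is the sum of the variances. For simple functions all integrals are finite sums
  over the values; the general case follows by dominated convergence.

  \<^emph>\<open>An iteration that solves all the equations \<open>E(\<eta>|F k) = \<xi> k\<close> at once.\<close> Let \<open>c\<close> be the common mean.
  Begin with the constant \<open>c\<close>, whose errors \<open>r k = \<xi> k - c\<close> are centred, and repeatedly add the
  average \<open>s = (\<Sum>k. r k) / n\<close> of the current errors to the approximation. Each error changes to
  \<open>r k - E(s|F k)\<close>, so it stays \<open>F k\<close>-measurable and centred. Writing \<open>R = (\<Sum>k. E (r k)\<^sup>2)\<close>, the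
  defining property of conditional expectation and its \<open>L\<^sup>2\<close> contractivity give
  \<open>R' \<le> R - 2 n E s\<^sup>2 + n E s\<^sup>2 = R - n E s\<^sup>2\<close> (\<open>energy_residual_step\<close>), while the independence
  inequality says \<open>n E s\<^sup>2 \<ge> (\<alpha>/n) R\<close>. Hence \<open>R\<close> decreases geometrically, and with it the \<open>L\<^sup>2\<close>
  norms of the corrections \<open>s\<close>. Their sum therefore converges to a square integrable variable
  (\<open>square_integrable_suminf_geometric\<close>), and integrating over a set of \<open>F k\<close> identifies the
  conditional expectations of the limit (\<open>ex_common_real_cond_exp\<close>).
\<close>

section \<open>Variance of a sum under a finite product distribution\<close>

text \<open>Bienayme's formula for independent centred variables with finitely many values: \<open>p i\<close> is the
  distribution of the \<open>i\<close>-th variable on its set of values \<open>V i\<close>. When the square is expanded, the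
  sum over the product factorises for each pair of indices; a pair of distinct indices contributes a
  factor that is a mean, hence zero.\<close>

lemma weighted_sum_square_PiE:
  fixes p :: "'i \<Rightarrow> real \<Rightarrow> real"
  assumes I: "finite I" and V: "\<And>i. i \<in> I \<Longrightarrow> finite (V i)"
    and total: "\<And>i. i \<in> I \<Longrightarrow> (\<Sum>y\<in>V i. p i y) = 1"
    and mean: "\<And>i. i \<in> I \<Longrightarrow> (\<Sum>y\<in>V i. y * p i y) = 0"
  shows "(\<Sum>v\<in>PiE I V. (\<Sum>i\<in>I. v i)\<^sup>2 * (\<Prod>i\<in>I. p i (v i))) = (\<Sum>i\<in>I. \<Sum>y\<in>V i. y\<^sup>2 * p i y)"
proof -
  \<comment> \<open>The \<open>i\<close>-th factor of \<open>v k * v l * (\<Prod>i\<in>I. p i (v i))\<close>; for \<open>k = l\<close> the two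
    conditions together produce the square.\<close>
  define w where "w k l i y = (if i = k then y else 1) * (if i = l then y else 1) * p i y"
    for k l i and y :: real
  have cross: "(\<Sum>v\<in>PiE I V. v k * v l * (\<Prod>i\<in>I. p i (v i))) = (\<Prod>i\<in>I. \<Sum>y\<in>V i. w k l i y)"
    if "k \<in> I" "l \<in> I" for k l
  proof -
    have "v k * v l * (\<Prod>i\<in>I. p i (v i)) = (\<Prod>i\<in>I. w k l i (v i))" for v
      using that I by (simp add: w_def prod.distrib)
    then show ?thesis
      by (simp add: prod_sum_PiE I V)
  qed
  have off_diagonal: "(\<Prod>i\<in>I. \<Sum>y\<in>V i. w k l i y) = 0" if "k \<in> I" "l \<in> I" "k \<noteq> l" for k l
  proof (rule prod_zero[OF I])
    have "(\<Sum>y\<in>V k. w k l k y) = 0"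
      using that mean by (simp add: w_def)
    then show "\<exists>i\<in>I. (\<Sum>y\<in>V i. w k l i y) = 0"
      using that by blast
  qed
  have diagonal: "(\<Prod>i\<in>I. \<Sum>y\<in>V i. w k k i y) = (\<Sum>y\<in>V k. y\<^sup>2 * p k y)" if "k \<in> I" for k
  proof -
    have "(\<Prod>i\<in>I - {k}. \<Sum>y\<in>V i. w k k i y) = 1"
      by (rule prod.neutral) (auto simp: w_def total)
    then show ?thesis
      by (simp add: prod.remove[OF I that] w_def power2_eq_square)
  qed
  have "(\<Sum>v\<in>PiE I V. (\<Sum>i\<in>I. v i)\<^sup>2 * (\<Prod>i\<in>I. p i (v i)))
      = (\<Sum>v\<in>PiE I V. \<Sum>k\<in>I. \<Sum>l\<in>I. v k * v l * (\<Prod>i\<in>I. p i (v i)))"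
    unfolding power2_eq_square sum_product by (simp only: sum_distrib_right)
  also have "\<dots> = (\<Sum>k\<in>I. \<Sum>l\<in>I. \<Sum>v\<in>PiE I V. v k * v l * (\<Prod>i\<in>I. p i (v i)))"
    by (subst sum.swap, rule sum.cong[OF refl], rule sum.swap)
  also have "\<dots> = (\<Sum>k\<in>I. \<Sum>l\<in>I. if l = k then \<Sum>y\<in>V k. y\<^sup>2 * p k y else 0)"
    by (intro sum.cong refl) (auto simp: cross off_diagonal diagonal)
  also have "\<dots> = (\<Sum>k\<in>I. \<Sum>y\<in>V k. y\<^sup>2 * p k y)"
    using I by simp
  finally show ?thesis .
qed

section \<open>Square integrable random variables\<close>

definition square_integrable :: "'a measure \<Rightarrow> ('a \<Rightarrow> real) \<Rightarrow> bool" where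
  "square_integrable M f \<longleftrightarrow> f \<in> borel_measurable M \<and> integrable M (\<lambda>x. (f x)\<^sup>2)"

lemma square_integrable_mult:
  assumes "square_integrable M f" "square_integrable M g"
  shows "integrable M (\<lambda>x. f x * g x)"
proof (rule Bochner_Integration.integrable_bound)
  show "integrable M (\<lambda>x. (f x)\<^sup>2 + (g x)\<^sup>2)"
    using assms by (simp add: square_integrable_def)
  show "(\<lambda>x. f x * g x) \<in> borel_measurable M"
    using assms by (auto simp: square_integrable_def)
  have "2 * \<bar>a * b\<bar> \<le> a\<^sup>2 + b\<^sup>2" for a b :: real
    using sum_squares_bound[of "\<bar>a\<bar>" "\<bar>b\<bar>"] by (simp add: abs_mult)
  then have "\<bar>a * b\<bar> \<le> a\<^sup>2 + b\<^sup>2" for a b :: real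
    by (smt (verit) abs_ge_zero)
  then show "AE x in M. norm (f x * g x) \<le> norm ((f x)\<^sup>2 + (g x)\<^sup>2)"
    by simp
qed

lemma square_integrable_add:
  assumes "square_integrable M f" "square_integrable M g"
  shows "square_integrable M (\<lambda>x. f x + g x)"
  using assms square_integrable_mult[OF assms]
  by (auto simp only: square_integrable_def power2_sum mult.assoc
      intro!: borel_measurable_add Bochner_Integration.integrable_add integrable_mult_right)

lemma square_integrable_cmult:
  assumes "square_integrable M f"
  shows "square_integrable M (\<lambda>x. c * f x)"
  using assms by (auto simp: square_integrable_def power_mult_distrib)

lemma square_integrable_diff:
  assumes "square_integrable M f" "square_integrable M g"
  shows "square_integrable M (\<lambda>x. f x - g x)"
  using square_integrable_add[OF assms(1) square_integrable_cmult[OF assms(2), of "- 1"]] by simp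

lemma square_integrable_sum:
  assumes "\<And>i. i \<in> I \<Longrightarrow> square_integrable M (f i)"
  shows "square_integrable M (\<lambda>x. \<Sum>i\<in>I. f i x)"
  using assms
  by (induction I rule: infinite_finite_induct)
     (simp_all add: square_integrable_add, simp_all add: square_integrable_def)

lemma square_integrable_bound:
  assumes "square_integrable M g" "f \<in> borel_measurable M" "\<And>x. x \<in> space M \<Longrightarrow> \<bar>f x\<bar> \<le> g x"
  shows "square_integrable M f"
  unfolding square_integrable_def
proof
  show "integrable M (\<lambda>x. (f x)\<^sup>2)"
  proof (rule Bochner_Integration.integrable_bound)
    show "integrable M (\<lambda>x. (g x)\<^sup>2)" "(\<lambda>x. (f x)\<^sup>2) \<in> borel_measurable M"
      using assms by (auto simp: square_integrable_def)
    show "AE x in M. norm ((f x)\<^sup>2) \<le> norm ((g x)\<^sup>2)"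
    proof (rule AE_I2)
      fix x assume "x \<in> space M"
      then have "\<bar>f x\<bar> \<le> \<bar>g x\<bar>"
        using assms(3) by force
      then show "norm ((f x)\<^sup>2) \<le> norm ((g x)\<^sup>2)"
        by (simp add: abs_le_square_iff)
    qed
  qed
qed fact

lemma summable_AE_if_summable_integral:
  fixes f :: "nat \<Rightarrow> 'a \<Rightarrow> real"
  assumes int: "\<And>i. integrable M (f i)" and nonneg: "\<And>i x. 0 \<le> f i x"
    and summable: "summable (\<lambda>i. \<integral>x. f i x \<partial>M)"
  shows "AE x in M. summable (\<lambda>i. f i x)"
proof -
  have [measurable]: "f i \<in> borel_measurable M" for i
    using int by auto
  have "(\<integral>\<^sup>+x. (\<Sum>i. ennreal (f i x)) \<partial>M) = (\<Sum>i. \<integral>\<^sup>+x. ennreal (f i x) \<partial>M)"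
    by (rule nn_integral_suminf) auto
  also have "\<dots> = (\<Sum>i. ennreal (\<integral>x. f i x \<partial>M))"
    by (simp add: nn_integral_eq_integral int nonneg)
  also have "\<dots> = ennreal (\<Sum>i. \<integral>x. f i x \<partial>M)"
    by (intro suminf_ennreal2 summable) (simp add: nonneg)
  finally have "(\<integral>\<^sup>+x. (\<Sum>i. ennreal (f i x)) \<partial>M) \<noteq> \<infinity>"
    by simp
  then have "AE x in M. (\<Sum>i. ennreal (f i x)) \<noteq> \<infinity>"
    by (intro nn_integral_PInf_AE) auto
  then show ?thesis
    by eventually_elim (auto intro!: summable_suminf_not_top simp: nonneg)
qed

context prob_space
begin

lemma square_integrable_const: "square_integrable M (\<lambda>x. c)"
  by (simp add: square_integrable_def)

lemma square_integrable_integrable: "square_integrable M f \<Longrightarrow> integrable M f"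
  unfolding square_integrable_def by (blast intro: square_integrable_imp_integrable)

text \<open>The part of the completeness of \<open>L\<^sup>2\<close> that the iteration needs. Geometric decay leaves room for
  weights: with \<open>\<rho> = sqrt q\<close>, the series of \<open>(d m)\<^sup>2 / \<rho> ^ m\<close> still has summable integrals, and by the
  Cauchy--Schwarz inequality it dominates \<open>(\<Sum>m. d m)\<^sup>2\<close> up to the factor \<open>\<Sum>m. \<rho> ^ m\<close>. Since
  \<open>\<bar>d m\<bar>\<close> is at most \<open>(d m)\<^sup>2 / \<rho> ^ m + \<rho> ^ m\<close>, the same series also gives the absolute convergence
  almost everywhere and in \<open>L\<^sup>1\<close> that allows integration term by term.\<close>

lemma
  fixes d :: "nat \<Rightarrow> 'a \<Rightarrow> real"
  assumes sq: "\<And>m. square_integrable M (d m)"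
    and bound: "\<And>m. expectation (\<lambda>x. (d m x)\<^sup>2) \<le> C * q ^ m" and q: "0 < q" "q < 1"
  shows square_integrable_suminf_geometric: "square_integrable M (\<lambda>x. \<Sum>m. d m x)"
    and set_integral_sums_geometric:
      "A \<in> events \<Longrightarrow> (\<lambda>m. LINT x:A|M. d m x) sums (LINT x:A|M. \<Sum>m. d m x)"
proof -
  have [measurable]: "d m \<in> borel_measurable M" for m
    using sq by (simp add: square_integrable_def)
  define \<rho> where "\<rho> = sqrt q"
  have \<rho>: "0 < \<rho>" "\<rho> < 1" "\<rho> * \<rho> = q"
    using q by (auto simp: \<rho>_def)
  define e where "e m x = (d m x)\<^sup>2 / \<rho> ^ m" for m x
  have e_nonneg: "0 \<le> e m x" for m x
    using \<rho> by (simp add: e_def)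
  have e_int: "integrable M (e m)" for m
    unfolding e_def using sq by (simp add: square_integrable_def)
  have e_le: "expectation (e m) \<le> C * \<rho> ^ m" for m
  proof -
    have "C * \<rho> ^ m = C * q ^ m / \<rho> ^ m"
      using \<rho>(1) by (simp flip: \<rho>(3) add: power_mult_distrib)
    then show ?thesis
      using bound[of m] \<rho>(1) by (simp add: e_def[abs_def] divide_right_mono)
  qed
  have geometric: "summable (\<lambda>m. \<rho> ^ m)"
    using \<rho> by (intro summable_geometric) simp
  have e_sum: "summable (\<lambda>m. expectation (e m))"
    by (rule summable_comparison_test'[where N = 0 and g = "\<lambda>m. C * \<rho> ^ m"])
       (use e_le e_nonneg geometric in \<open>auto intro: summable_mult\<close>)
  have e_AE: "AE x in M. summable (\<lambda>m. e m x)"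
    by (rule summable_AE_if_summable_integral[OF e_int e_nonneg e_sum])
  have d_le: "\<bar>d m x\<bar> \<le> e m x + \<rho> ^ m" for m x
  proof -
    have "0 \<le> (\<bar>d m x\<bar> - \<rho> ^ m)\<^sup>2"
      by simp
    then have "2 * \<bar>d m x\<bar> * \<rho> ^ m \<le> (d m x)\<^sup>2 + \<rho> ^ m * \<rho> ^ m"
      by (simp add: power2_eq_square algebra_simps)
    moreover have "0 \<le> \<bar>d m x\<bar> * \<rho> ^ m"
      using \<rho>(1) by simp
    ultimately have "\<bar>d m x\<bar> * \<rho> ^ m \<le> (d m x)\<^sup>2 + \<rho> ^ m * \<rho> ^ m"
      by linarith
    then show ?thesis
      using \<rho>(1) by (simp add: e_def field_simps)
  qed
  have d_int: "integrable M (d m)" for m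
    using sq by (rule square_integrable_integrable)
  have d_AE: "AE x in M. summable (\<lambda>m. \<bar>d m x\<bar>)"
    using e_AE
  proof eventually_elim
    case (elim x)
    show ?case
      by (rule summable_comparison_test'[where N = 0, OF summable_add[OF elim geometric]])
         (simp add: d_le)
  qed
  have d_sum: "summable (\<lambda>m. expectation (\<lambda>x. \<bar>d m x\<bar>))"
  proof (rule summable_comparison_test'[where N = 0, OF summable_add[OF e_sum geometric]])
    fix m
    have "expectation (\<lambda>x. \<bar>d m x\<bar>) \<le> expectation (\<lambda>x. e m x + \<rho> ^ m)"
      using d_int e_int d_le by (intro integral_mono) auto
    then show "norm (expectation (\<lambda>x. \<bar>d m x\<bar>)) \<le> expectation (e m) + \<rho> ^ m"
      using e_int by (simp add: prob_space)
  qed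
  have e_total: "integrable M (\<lambda>x. \<Sum>m. e m x)"
    using e_int e_AE e_sum e_nonneg by (intro integrable_suminf) simp_all
  show "square_integrable M (\<lambda>x. \<Sum>m. d m x)"
    unfolding square_integrable_def
  proof
    show "integrable M (\<lambda>x. (\<Sum>m. d m x)\<^sup>2)"
    proof (rule Bochner_Integration.integrable_bound)
      show "integrable M (\<lambda>x. (\<Sum>m. \<rho> ^ m) * (\<Sum>m. e m x))"
        using e_total by simp
      show "AE x in M. norm ((\<Sum>m. d m x)\<^sup>2) \<le> norm ((\<Sum>m. \<rho> ^ m) * (\<Sum>m. e m x))"
        using e_AE d_AE
      proof eventually_elim
        case (elim x)
        have "(\<Sum>m<N. d m x)\<^sup>2 \<le> (\<Sum>m. \<rho> ^ m) * (\<Sum>m. e m x)" for N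
        proof -
          have "(\<Sum>m<N. d m x)\<^sup>2 = (\<Sum>m<N. sqrt (\<rho> ^ m) * (d m x / sqrt (\<rho> ^ m)))\<^sup>2"
            using \<rho>(1) by simp
          also have "\<dots> \<le> (\<Sum>m<N. (sqrt (\<rho> ^ m))\<^sup>2) * (\<Sum>m<N. (d m x / sqrt (\<rho> ^ m))\<^sup>2)"
            by (rule Cauchy_Schwarz_ineq_sum)
          also have "\<dots> = (\<Sum>m<N. \<rho> ^ m) * (\<Sum>m<N. e m x)"
            using \<rho>(1) by (simp add: e_def power_divide)
          also have "\<dots> \<le> (\<Sum>m. \<rho> ^ m) * (\<Sum>m. e m x)"
            using \<rho>(1) e_nonneg elim(1) geometric
            by (intro mult_mono sum_le_suminf sum_nonneg suminf_nonneg) auto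
          finally show ?thesis .
        qed
        moreover have "(\<lambda>N. (\<Sum>m<N. d m x)\<^sup>2) \<longlonglongrightarrow> (\<Sum>m. d m x)\<^sup>2"
          using elim(2) by (intro tendsto_power summable_LIMSEQ) (rule summable_rabs_cancel)
        ultimately have "(\<Sum>m. d m x)\<^sup>2 \<le> (\<Sum>m. \<rho> ^ m) * (\<Sum>m. e m x)"
          by (intro LIMSEQ_le_const2) auto
        then show ?case
          by simp
      qed
    qed simp
  qed simp
  show "(\<lambda>m. LINT x:A|M. d m x) sums (LINT x:A|M. \<Sum>m. d m x)" if A: "A \<in> events"
  proof -
    have "(\<lambda>m. LINT x|M. indicator A x * d m x) sums (LINT x|M. (\<Sum>m. indicator A x * d m x))"
    proof (rule sums_integral)
      show "integrable M (\<lambda>x. indicator A x * d m x)" for m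
        using integrable_mult_indicator[OF A d_int] by simp
      show "AE x in M. summable (\<lambda>m. norm (indicator A x * d m x))"
        using d_AE by eventually_elim (auto simp: indicator_def)
      show "summable (\<lambda>m. LINT x|M. norm (indicator A x * d m x))"
      proof (rule summable_comparison_test'[where N = 0, OF d_sum])
        fix m
        have "(LINT x|M. norm (indicator A x * d m x)) \<le> expectation (\<lambda>x. \<bar>d m x\<bar>)"
          using integrable_mult_indicator[OF A d_int[of m]] d_int[of m]
          by (intro integral_mono integrable_norm) (auto simp: indicator_def)
        then show "norm (LINT x|M. norm (indicator A x * d m x)) \<le> expectation (\<lambda>x. \<bar>d m x\<bar>)"
          by simp
      qed
    qed
    moreover have "AE x in M. (\<Sum>m. indicator A x * d m x) = indicator A x * (\<Sum>m. d m x)"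
      by (rule AE_I2) (simp add: indicator_def)
    then have "(LINT x|M. (\<Sum>m. indicator A x * d m x)) = (LINT x|M. indicator A x * (\<Sum>m. d m x))"
      using A by (intro integral_cong_AE) auto
    ultimately show ?thesis
      by (simp add: set_lebesgue_integral_def)
  qed
qed

text \<open>Conditional expectation is a contraction of \<open>L\<^sup>2\<close>, by Jensen's inequality for the square.\<close>

lemma
  assumes sub: "subalgebra M G" and sq: "square_integrable M g"
  shows square_integrable_real_cond_exp: "square_integrable M (real_cond_exp M G g)"
    and expectation_square_real_cond_exp_le:
      "expectation (\<lambda>x. (real_cond_exp M G g x)\<^sup>2) \<le> expectation (\<lambda>x. (g x)\<^sup>2)"
proof -
  interpret finite_measure_subalgebra M G
    by standard (rule sub)
  have g: "integrable M g" and g2: "integrable M (\<lambda>x. (g x)\<^sup>2)"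
    using square_integrable_integrable[OF sq] sq by (simp_all add: square_integrable_def)
  have int: "integrable M (\<lambda>x. (real_cond_exp M G g x)\<^sup>2)"
    using g g2 by (intro integrable_convex_cond_exp[where I = UNIV and q = power2] convex_power2) auto
  then show "square_integrable M (real_cond_exp M G g)"
    by (simp add: square_integrable_def)
  have "AE x in M. (real_cond_exp M G g x)\<^sup>2 \<le> real_cond_exp M G (\<lambda>x. (g x)\<^sup>2) x"
    using g g2 by (intro real_cond_exp_jensens_inequality[where I = UNIV and q = power2] convex_power2) auto
  then have "expectation (\<lambda>x. (real_cond_exp M G g x)\<^sup>2) \<le> expectation (real_cond_exp M G (\<lambda>x. (g x)\<^sup>2))"
    using int real_cond_exp_int(1)[OF g2] by (intro integral_mono_AE) auto
  then show "expectation (\<lambda>x. (real_cond_exp M G g x)\<^sup>2) \<le> expectation (\<lambda>x. (g x)\<^sup>2)"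
    by (simp add: real_cond_exp_int(2)[OF g2])
qed

end

section \<open>Linear independence of centred variables\<close>

locale quasi_independent = prob_space M for M :: "'a measure" +
  fixes F :: "'i \<Rightarrow> 'a measure" and I :: "'i set" and \<alpha> :: real
  assumes finite_index: "finite I" and nonempty_index: "I \<noteq> {}"
    and subalgebra_F: "\<And>k. k \<in> I \<Longrightarrow> subalgebra M (F k)"
    and pos: "\<alpha> > 0"
    and prob_Inter_ge: "\<And>A. (\<And>k. k \<in> I \<Longrightarrow> A k \<in> sets (F k)) \<Longrightarrow>
      prob (\<Inter>k\<in>I. A k) \<ge> \<alpha> * (\<Prod>k\<in>I. prob (A k))"
begin

text \<open>For simple functions the expectation of \<open>(\<Sum>k\<in>I. f k)\<^sup>2\<close> is a finite sum over the tuples \<open>v\<close> of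
  values, with the nonnegative coefficients \<open>(\<Sum>k\<in>I. v k)\<^sup>2\<close>. So it can only decrease when the
  probability that all \<open>f k\<close> take the values \<open>v k\<close> is replaced by \<open>\<alpha>\<close> times the product of the
  individual probabilities, and for the product the cross terms vanish.\<close>

lemma simple_sum_square_ge:
  assumes simple: "\<And>k. k \<in> I \<Longrightarrow> simple_function (F k) (f k)"
    and mean: "\<And>k. k \<in> I \<Longrightarrow> expectation (f k) = 0"
  shows "expectation (\<lambda>x. (\<Sum>k\<in>I. f k x)\<^sup>2) \<ge> \<alpha> * (\<Sum>k\<in>I. expectation (\<lambda>x. (f k x)\<^sup>2))"
proof -
  have space_F: "space (F k) = space M" if "k \<in> I" for k
    using subalgebra_F[OF that] by (simp add: subalgebra_def)
  define V where "V k = f k ` space M" for k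
  define L where "L k y = f k -` {y} \<inter> space M" for k y
  have V: "finite (V k)" if "k \<in> I" for k
    using simple_functionD(1)[OF simple[OF that]] by (simp add: V_def space_F that)
  have L: "L k y \<in> sets (F k)" if "k \<in> I" for k y
    using simple_functionD(2)[OF simple[OF that]] by (simp add: L_def space_F[OF that, symmetric])
  have L_M: "L k y \<in> events" if "k \<in> I" for k y
    using L[OF that] subalgebra_F[OF that] by (auto simp: subalgebra_def)
  have level: "(\<Sum>y\<in>V k. \<phi> y * indicator (L k y) x) = \<phi> (f k x)"
    if "k \<in> I" "x \<in> space M" for k x and \<phi> :: "real \<Rightarrow> real"
  proof -
    have "(\<Sum>y\<in>V k. \<phi> y * indicator (L k y) x) = (\<Sum>y\<in>V k. if y = f k x then \<phi> y else 0)"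
      using that by (intro sum.cong refl) (auto simp: L_def indicator_def)
    also have "\<dots> = \<phi> (f k x)"
      using that V by (simp add: V_def)
    finally show ?thesis .
  qed
  have marginal: "expectation (\<lambda>x. \<phi> (f k x)) = (\<Sum>y\<in>V k. \<phi> y * prob (L k y))"
    if "k \<in> I" for k and \<phi> :: "real \<Rightarrow> real"
  proof -
    have "expectation (\<lambda>x. \<phi> (f k x)) = expectation (\<lambda>x. \<Sum>y\<in>V k. \<phi> y * indicator (L k y) x)"
      using that by (intro Bochner_Integration.integral_cong refl) (simp add: level)
    also have "\<dots> = (\<Sum>y\<in>V k. \<phi> y * prob (L k y))"
      using that L_M by (simp add: Bochner_Integration.integral_sum emeasure_eq_measure)
    finally show ?thesis .
  qed
  define J where "J v = (\<Inter>k\<in>I. L k (v k))" for v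
  have J_M: "J v \<in> events" for v
    unfolding J_def using L_M by (intro sets.finite_INT finite_index nonempty_index) auto
  have joint: "expectation (\<lambda>x. (\<Sum>k\<in>I. f k x)\<^sup>2) = (\<Sum>v\<in>PiE I V. (\<Sum>k\<in>I. v k)\<^sup>2 * prob (J v))"
  proof -
    have "(\<Sum>v\<in>PiE I V. (\<Sum>k\<in>I. v k)\<^sup>2 * indicator (J v) x) = (\<Sum>k\<in>I. f k x)\<^sup>2"
      if "x \<in> space M" for x
    proof -
      let ?v = "\<lambda>k\<in>I. f k x"
      have "(\<Sum>v\<in>PiE I V. (\<Sum>k\<in>I. v k)\<^sup>2 * indicator (J v) x)
          = (\<Sum>v\<in>PiE I V. if v = ?v then (\<Sum>k\<in>I. v k)\<^sup>2 else 0)"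
      proof (intro sum.cong refl)
        fix v assume "v \<in> PiE I V"
        then have "x \<in> J v \<longleftrightarrow> v = ?v"
          using that nonempty_index by (auto simp: J_def L_def fun_eq_iff PiE_def extensional_def)
        then show "(\<Sum>k\<in>I. v k)\<^sup>2 * indicator (J v) x = (if v = ?v then (\<Sum>k\<in>I. v k)\<^sup>2 else 0)"
          by (simp add: indicator_def)
      qed
      also have "\<dots> = (\<Sum>k\<in>I. f k x)\<^sup>2"
        using that V finite_index by (simp add: finite_PiE V_def)
      finally show ?thesis .
    qed
    then have "expectation (\<lambda>x. (\<Sum>k\<in>I. f k x)\<^sup>2)
        = expectation (\<lambda>x. \<Sum>v\<in>PiE I V. (\<Sum>k\<in>I. v k)\<^sup>2 * indicator (J v) x)"
      by (intro Bochner_Integration.integral_cong refl) simp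
    also have "\<dots> = (\<Sum>v\<in>PiE I V. (\<Sum>k\<in>I. v k)\<^sup>2 * prob (J v))"
      using J_M by (simp add: Bochner_Integration.integral_sum emeasure_eq_measure)
    finally show ?thesis .
  qed
  have "\<alpha> * (\<Sum>k\<in>I. expectation (\<lambda>x. (f k x)\<^sup>2)) = \<alpha> * (\<Sum>k\<in>I. \<Sum>y\<in>V k. y\<^sup>2 * prob (L k y))"
    by (simp add: marginal[of _ "\<lambda>y. y\<^sup>2"])
  also have "\<dots> = \<alpha> * (\<Sum>v\<in>PiE I V. (\<Sum>k\<in>I. v k)\<^sup>2 * (\<Prod>k\<in>I. prob (L k (v k))))"
    using marginal[of _ "\<lambda>y. 1"] marginal[of _ "\<lambda>y. y"] mean
    by (subst weighted_sum_square_PiE) (auto simp: finite_index V prob_space)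
  also have "\<dots> = (\<Sum>v\<in>PiE I V. (\<Sum>k\<in>I. v k)\<^sup>2 * (\<alpha> * (\<Prod>k\<in>I. prob (L k (v k)))))"
    by (simp add: sum_distrib_left mult_ac)
  also have "\<dots> \<le> (\<Sum>v\<in>PiE I V. (\<Sum>k\<in>I. v k)\<^sup>2 * prob (J v))"
    unfolding J_def by (intro sum_mono mult_left_mono prob_Inter_ge L) auto
  finally show ?thesis
    by (simp add: joint)
qed

text \<open>Simple functions approximating a centred function need not be centred. Subtracting their means
  repairs this, keeps them simple, and does not change the limit because the means tend to zero.\<close>

lemma sum_square_ge:
  assumes meas: "\<And>k. k \<in> I \<Longrightarrow> f k \<in> borel_measurable (F k)"
    and sq: "\<And>k. k \<in> I \<Longrightarrow> square_integrable M (f k)"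
    and mean: "\<And>k. k \<in> I \<Longrightarrow> expectation (f k) = 0"
  shows "expectation (\<lambda>x. (\<Sum>k\<in>I. f k x)\<^sup>2) \<ge> \<alpha> * (\<Sum>k\<in>I. expectation (\<lambda>x. (f k x)\<^sup>2))"
proof -
  have space_F: "space (F k) = space M" if "k \<in> I" for k
    using subalgebra_F[OF that] by (simp add: subalgebra_def)
  have f_M: "f k \<in> borel_measurable M" if "k \<in> I" for k
    using sq[OF that] by (simp add: square_integrable_def)
  have f_int: "integrable M (f k)" if "k \<in> I" for k
    using sq[OF that] by (rule square_integrable_integrable)
  have "\<exists>s. (\<forall>i. simple_function (F k) (s i)) \<and> (\<forall>x\<in>space M. (\<lambda>i. s i x) \<longlonglongrightarrow> f k x) \<and>
      (\<forall>i. \<forall>x\<in>space M. \<bar>s i x\<bar> \<le> 2 * \<bar>f k x\<bar>)" if "k \<in> I" for k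
    using borel_measurable_implies_sequence_metric[OF meas[OF that], of 0]
    by (simp add: space_F[OF that])
  then obtain s where s_simple: "\<And>k i. k \<in> I \<Longrightarrow> simple_function (F k) (s k i)"
    and s_lim: "\<And>k x. k \<in> I \<Longrightarrow> x \<in> space M \<Longrightarrow> (\<lambda>i. s k i x) \<longlonglongrightarrow> f k x"
    and s_le: "\<And>k i x. k \<in> I \<Longrightarrow> x \<in> space M \<Longrightarrow> \<bar>s k i x\<bar> \<le> 2 * \<bar>f k x\<bar>"
    by metis
  have s_M: "s k i \<in> borel_measurable M" if "k \<in> I" for k i
    by (rule measurable_from_subalg[OF subalgebra_F[OF that]])
       (rule borel_measurable_simple_function[OF s_simple[OF that]])
  have s_int: "integrable M (s k i)" if "k \<in> I" for k i
    by (rule Bochner_Integration.integrable_bound[of M "\<lambda>x. 2 * f k x"])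
       (use that f_int s_M s_le in \<open>auto intro!: AE_I2 simp: abs_mult\<close>)
  have s_mean: "(\<lambda>i. expectation (s k i)) \<longlonglongrightarrow> 0" if "k \<in> I" for k
    unfolding mean[OF that, symmetric]
    by (rule integral_dominated_convergence[where w = "\<lambda>x. 2 * \<bar>f k x\<bar>"])
       (use that f_int f_M s_M s_lim s_le in \<open>auto intro!: AE_I2\<close>)
  define t where "t k i x = s k i x - expectation (s k i)" for k i x
  have t_simple: "simple_function (F k) (t k i)" if "k \<in> I" for k i
    unfolding t_def using s_simple[OF that] by (intro simple_function_diff) auto
  have t_mean: "expectation (t k i) = 0" if "k \<in> I" for k i
    unfolding t_def using s_int[OF that] by (simp add: prob_space)
  have t_M: "t k i \<in> borel_measurable M" if "k \<in> I" for k i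
    unfolding t_def using s_M[OF that] by simp
  have t_lim: "(\<lambda>i. t k i x) \<longlonglongrightarrow> f k x" if "k \<in> I" "x \<in> space M" for k x
    unfolding t_def using tendsto_diff[OF s_lim[OF that] s_mean[OF that(1)]] by simp
  define g where "g k x = 2 * \<bar>f k x\<bar> + 2 * expectation (\<lambda>x. \<bar>f k x\<bar>)" for k x
  have g_sq: "square_integrable M (g k)" if "k \<in> I" for k
    unfolding g_def using sq[OF that]
    by (intro square_integrable_add square_integrable_cmult square_integrable_const)
       (simp add: square_integrable_def borel_measurable_abs)
  have t_le: "\<bar>t k i x\<bar> \<le> g k x" if "k \<in> I" "x \<in> space M" for k i x
  proof -
    have "\<bar>expectation (s k i)\<bar> \<le> expectation (\<lambda>x. \<bar>s k i x\<bar>)"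
      using integral_norm_bound[of M "s k i"] by simp
    also have "\<dots> \<le> expectation (\<lambda>x. 2 * \<bar>f k x\<bar>)"
      using that(1) f_int s_int s_le by (intro integral_mono) auto
    finally show ?thesis
      using s_le[OF that, of i] by (simp add: t_def g_def)
  qed
  have lim_sum: "(\<lambda>i. expectation (\<lambda>x. (\<Sum>k\<in>I. t k i x)\<^sup>2)) \<longlonglongrightarrow> expectation (\<lambda>x. (\<Sum>k\<in>I. f k x)\<^sup>2)"
  proof (rule integral_dominated_convergence[where w = "\<lambda>x. (\<Sum>k\<in>I. g k x)\<^sup>2"])
    show "integrable M (\<lambda>x. (\<Sum>k\<in>I. g k x)\<^sup>2)"
      using square_integrable_sum[of I M g] g_sq by (simp add: square_integrable_def)
    show "AE x in M. (\<lambda>i. (\<Sum>k\<in>I. t k i x)\<^sup>2) \<longlonglongrightarrow> (\<Sum>k\<in>I. f k x)\<^sup>2"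
      by (intro AE_I2 tendsto_power tendsto_sum t_lim)
    show "AE x in M. norm ((\<Sum>k\<in>I. t k i x)\<^sup>2) \<le> (\<Sum>k\<in>I. g k x)\<^sup>2" for i
    proof (rule AE_I2)
      fix x assume "x \<in> space M"
      then have "\<bar>\<Sum>k\<in>I. t k i x\<bar> \<le> (\<Sum>k\<in>I. g k x)"
        by (intro order.trans[OF sum_abs] sum_mono t_le)
      then show "norm ((\<Sum>k\<in>I. t k i x)\<^sup>2) \<le> (\<Sum>k\<in>I. g k x)\<^sup>2"
        by (simp add: abs_le_square_iff[symmetric])
    qed
  qed (use f_M t_M in measurable)
  have lim_each: "(\<lambda>i. expectation (\<lambda>x. (t k i x)\<^sup>2)) \<longlonglongrightarrow> expectation (\<lambda>x. (f k x)\<^sup>2)"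
    if "k \<in> I" for k
  proof (rule integral_dominated_convergence[where w = "\<lambda>x. (g k x)\<^sup>2"])
    show "integrable M (\<lambda>x. (g k x)\<^sup>2)"
      using g_sq[OF that] by (simp add: square_integrable_def)
    show "AE x in M. (\<lambda>i. (t k i x)\<^sup>2) \<longlonglongrightarrow> (f k x)\<^sup>2"
      by (intro AE_I2 tendsto_power t_lim that)
    show "AE x in M. norm ((t k i x)\<^sup>2) \<le> (g k x)\<^sup>2" for i
    proof (rule AE_I2)
      fix x assume "x \<in> space M"
      then have "\<bar>t k i x\<bar> \<le> g k x"
        by (rule t_le[OF that])
      then show "norm ((t k i x)\<^sup>2) \<le> (g k x)\<^sup>2"
        by (simp add: abs_le_square_iff[symmetric])
    qed
  qed (use f_M t_M that in measurable)
  show ?thesis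
  proof (rule LIMSEQ_le)
    show "(\<lambda>i. \<alpha> * (\<Sum>k\<in>I. expectation (\<lambda>x. (t k i x)\<^sup>2)))
        \<longlonglongrightarrow> \<alpha> * (\<Sum>k\<in>I. expectation (\<lambda>x. (f k x)\<^sup>2))"
      by (intro tendsto_mult_left tendsto_sum lim_each)
    show "\<exists>N. \<forall>i\<ge>N. \<alpha> * (\<Sum>k\<in>I. expectation (\<lambda>x. (t k i x)\<^sup>2))
        \<le> expectation (\<lambda>x. (\<Sum>k\<in>I. t k i x)\<^sup>2)"
      by (intro exI allI impI simple_sum_square_ge t_simple t_mean)
  qed (rule lim_sum)
qed

section \<open>Iterative correction of the errors\<close>

definition centered_family :: "('i \<Rightarrow> 'a \<Rightarrow> real) \<Rightarrow> bool" where
  "centered_family r \<longleftrightarrow> (\<forall>k\<in>I. r k \<in> borel_measurable (F k) \<and>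
     square_integrable M (r k) \<and> expectation (r k) = 0)"

definition energy :: "('i \<Rightarrow> 'a \<Rightarrow> real) \<Rightarrow> real" where
  "energy r = (\<Sum>k\<in>I. expectation (\<lambda>x. (r k x)\<^sup>2))"

text \<open>With the factor \<open>1 / card I\<close> the quadratic term in \<open>energy_residual_step\<close> is at most half of the
  cross term.\<close>

definition correction :: "('i \<Rightarrow> 'a \<Rightarrow> real) \<Rightarrow> 'a \<Rightarrow> real" where
  "correction r x = (1 / card I) * (\<Sum>l\<in>I. r l x)"

definition residual_step :: "('i \<Rightarrow> 'a \<Rightarrow> real) \<Rightarrow> 'i \<Rightarrow> 'a \<Rightarrow> real" where
  "residual_step r k x = r k x - real_cond_exp M (F k) (correction r) x"

lemma card_index: "card I > 0"
  using finite_index nonempty_index by (simp add: card_gt_0_iff)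

lemma finite_measure_subalgebra: "k \<in> I \<Longrightarrow> finite_measure_subalgebra M (F k)"
  by (intro finite_measure_subalgebra.intro finite_measure_axioms finite_measure_subalgebra_axioms.intro subalgebra_F)

lemma square_integrable_correction:
  assumes "centered_family r"
  shows "square_integrable M (correction r)"
  unfolding correction_def using assms
  by (intro square_integrable_cmult square_integrable_sum) (simp add: centered_family_def)

lemma expectation_correction:
  assumes "centered_family r"
  shows "expectation (correction r) = 0"
proof -
  have "integrable M (r k)" "expectation (r k) = 0" if "k \<in> I" for k
    using assms that by (auto simp: centered_family_def intro: square_integrable_integrable)
  then show ?thesis
    by (simp add: correction_def[abs_def])
qed

lemma centered_family_residual_step:
  assumes "centered_family r"
  shows "centered_family (residual_step r)"
  unfolding centered_family_def
proof (intro ballI conjI)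
  fix k assume k: "k \<in> I"
  interpret finite_measure_subalgebra M "F k"
    by (rule finite_measure_subalgebra[OF k])
  have r: "r k \<in> borel_measurable (F k)" "square_integrable M (r k)" "expectation (r k) = 0"
    using assms k by (auto simp: centered_family_def)
  have c: "integrable M (correction r)"
    by (rule square_integrable_integrable[OF square_integrable_correction[OF assms]])
  show "residual_step r k \<in> borel_measurable (F k)"
    unfolding residual_step_def[abs_def] using r(1) by simp
  show "square_integrable M (residual_step r k)"
    unfolding residual_step_def[abs_def]
    by (intro square_integrable_diff r(2) square_integrable_real_cond_exp
        square_integrable_correction assms subalgebra_F k)
  show "expectation (residual_step r k) = 0"
    using square_integrable_integrable[OF r(2)] r(3) real_cond_exp_int[OF c]
    by (simp add: residual_step_def[abs_def] expectation_correction[OF assms])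
qed

text \<open>Expand the squares. As \<open>r k\<close> is \<open>F k\<close>-measurable, the cross term
  \<open>E (r k * E(s|F k))\<close> equals \<open>E (r k * s)\<close>, where \<open>s\<close> is the correction, and summing over \<open>k\<close> turns
  \<open>\<Sum>k\<in>I. r k\<close> into \<open>card I * s\<close>; the quadratic terms are bounded by contractivity.\<close>

lemma energy_residual_step:
  assumes r: "centered_family r"
  shows "energy (residual_step r) \<le> energy r - card I * expectation (\<lambda>x. (correction r x)\<^sup>2)"
proof -
  let ?c = "correction r"
  let ?n = "real (card I)"
  have c: "square_integrable M ?c"
    by (rule square_integrable_correction[OF r])
  have step: "expectation (\<lambda>x. (residual_step r k x)\<^sup>2)
      \<le> expectation (\<lambda>x. (r k x)\<^sup>2) - 2 * expectation (\<lambda>x. r k x * ?c x) + expectation (\<lambda>x. (?c x)\<^sup>2)"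
    if k: "k \<in> I" for k
  proof -
    interpret finite_measure_subalgebra M "F k"
      by (rule finite_measure_subalgebra[OF k])
    let ?P = "real_cond_exp M (F k) ?c"
    have rk: "r k \<in> borel_measurable (F k)" "square_integrable M (r k)"
      using r k by (auto simp: centered_family_def)
    have P: "square_integrable M ?P"
      by (rule square_integrable_real_cond_exp[OF subalgebra_F[OF k] c])
    have "expectation (\<lambda>x. (residual_step r k x)\<^sup>2)
        = expectation (\<lambda>x. (r k x)\<^sup>2 - 2 * (r k x * ?P x) + (?P x)\<^sup>2)"
      by (simp add: residual_step_def power2_diff add_diff_eq diff_add_eq mult.assoc)
    also have "\<dots> = expectation (\<lambda>x. (r k x)\<^sup>2) - 2 * expectation (\<lambda>x. r k x * ?P x)
        + expectation (\<lambda>x. (?P x)\<^sup>2)"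
      using rk(2) P square_integrable_mult[OF rk(2) P] by (simp add: square_integrable_def)
    also have "expectation (\<lambda>x. r k x * ?P x) = expectation (\<lambda>x. r k x * ?c x)"
      using c by (intro real_cond_exp_intg(2) square_integrable_mult rk) (simp_all add: square_integrable_def)
    finally show ?thesis
      using expectation_square_real_cond_exp_le[OF subalgebra_F[OF k] c] by linarith
  qed
  have "(\<Sum>k\<in>I. expectation (\<lambda>x. r k x * ?c x)) = expectation (\<lambda>x. \<Sum>k\<in>I. r k x * ?c x)"
    using r by (intro Bochner_Integration.integral_sum[symmetric] square_integrable_mult c)
      (simp add: centered_family_def)
  also have "\<dots> = expectation (\<lambda>x. ?n * (?c x)\<^sup>2)"
  proof -
    have "(\<Sum>k\<in>I. r k x) = ?n * ?c x" for x
      using card_index by (simp add: correction_def)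
    then show ?thesis
      by (simp add: sum_distrib_right[symmetric] power2_eq_square mult.assoc)
  qed
  finally have cross: "(\<Sum>k\<in>I. expectation (\<lambda>x. r k x * ?c x)) = ?n * expectation (\<lambda>x. (?c x)\<^sup>2)"
    by simp
  have "energy (residual_step r) \<le> (\<Sum>k\<in>I. expectation (\<lambda>x. (r k x)\<^sup>2)
      - 2 * expectation (\<lambda>x. r k x * ?c x) + expectation (\<lambda>x. (?c x)\<^sup>2))"
    unfolding energy_def by (intro sum_mono step)
  also have "\<dots> = energy r - ?n * expectation (\<lambda>x. (?c x)\<^sup>2)"
    by (simp add: energy_def sum.distrib sum_subtractf sum_distrib_left[symmetric] cross)
  finally show ?thesis .
qed

lemma energy_nonneg: "energy r \<ge> 0"
  unfolding energy_def by (intro sum_nonneg) simp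

text \<open>The corrections are controlled by the errors because the energy that a step removes cannot exceed
  the energy that was there.\<close>

lemma correction_square_le_energy:
  assumes "centered_family r"
  shows "expectation (\<lambda>x. (correction r x)\<^sup>2) \<le> energy r"
proof -
  let ?E = "expectation (\<lambda>x. (correction r x)\<^sup>2)"
  have "card I * ?E \<le> energy r"
    using energy_residual_step[OF assms] energy_nonneg[of "residual_step r"] by linarith
  moreover have "1 * ?E \<le> card I * ?E"
    using card_index by (intro mult_right_mono) auto
  ultimately show ?thesis
    by linarith
qed

text \<open>Linear independence bounds the energy that a step removes from below by a fixed proportion of the
  energy present.\<close>

lemma energy_contraction:
  assumes r: "centered_family r"
  shows "energy (residual_step r) \<le> (1 - \<alpha> / card I) * energy r"
proof -
  let ?n = "real (card I)"
  have n: "?n > 0"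
    using card_index by simp
  have "\<alpha> * energy r \<le> expectation (\<lambda>x. (\<Sum>k\<in>I. r k x)\<^sup>2)"
    unfolding energy_def using r by (intro sum_square_ge) (auto simp: centered_family_def)
  also have "\<dots> = ?n * (?n * expectation (\<lambda>x. (correction r x)\<^sup>2))"
    using n by (simp add: correction_def power_mult_distrib power_divide power2_eq_square)
  finally have "\<alpha> / ?n * energy r \<le> ?n * expectation (\<lambda>x. (correction r x)\<^sup>2)"
    using n by (simp add: field_simps)
  then show ?thesis
    using energy_residual_step[OF r] by (simp add: left_diff_distrib)
qed

text \<open>Take all the sets \<open>A k\<close> equal to the whole space. The bound makes the contraction factor
  nonnegative.\<close>

lemma alpha_le_1: "\<alpha> \<le> 1"
proof -
  have "\<alpha> * (\<Prod>k\<in>I. prob (space M)) \<le> prob (\<Inter>k\<in>I. space M)"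
    using subalgebra_F by (intro prob_Inter_ge) (metis sets.top subalgebra_def)
  then show ?thesis
    using nonempty_index by (simp add: prob_space)
qed

section \<open>A variable with prescribed conditional expectations\<close>

text \<open>The integral over \<open>A \<in> F k\<close> of the error \<open>r N k\<close> equals that of
  \<open>\<xi> k - c - (\<Sum>m<N. d m)\<close>, since a correction and its conditional expectation have the same integral
  there. It tends to zero with the energy, so \<open>\<xi> k\<close> and \<open>c + (\<Sum>m. d m)\<close> have equal integrals over
  all sets of \<open>F k\<close>.\<close>

theorem ex_common_real_cond_exp:
  assumes meas: "\<And>k. k \<in> I \<Longrightarrow> \<xi> k \<in> borel_measurable (F k)"
    and sq: "\<And>k. k \<in> I \<Longrightarrow> square_integrable M (\<xi> k)"
    and mean: "\<And>k. k \<in> I \<Longrightarrow> expectation (\<xi> k) = c"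
  shows "\<exists>\<eta>. square_integrable M \<eta> \<and> (\<forall>k\<in>I. AE x in M. real_cond_exp M (F k) \<eta> x = \<xi> k x)"
proof -
  define r where "r m = (residual_step ^^ m) (\<lambda>k x. \<xi> k x - c)" for m
  have r_Suc: "r (Suc m) = residual_step (r m)" for m
    by (simp add: r_def)
  have r_centered: "centered_family (r m)" for m
  proof (induction m)
    case 0
    have "integrable M (\<xi> k)" if "k \<in> I" for k
      using sq[OF that] by (rule square_integrable_integrable)
    then show ?case
      using meas sq mean
      by (auto simp: centered_family_def r_def prob_space
          intro!: square_integrable_diff square_integrable_const)
  next
    case (Suc m)
    then show ?case
      by (simp add: r_Suc centered_family_residual_step)
  qed
  have r_sq: "square_integrable M (r m k)" if "k \<in> I" for m k
    using r_centered[of m] that by (simp add: centered_family_def)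
  \<comment> \<open>The factor \<open>1 - \<alpha> / card I\<close> vanishes when \<open>\<alpha> = card I = 1\<close>; halving the decrement keeps the
    ratio of the geometric series strictly positive.\<close>
  define q where "q = 1 - \<alpha> / (2 * card I)"
  have n: "real (card I) \<ge> 1"
    using card_index by simp
  have q: "0 < q" "q < 1" "1 - \<alpha> / card I \<le> q"
    using n pos alpha_le_1 by (auto simp: q_def field_simps)
  have energy_r: "energy (r m) \<le> energy (r 0) * q ^ m" for m
  proof (induction m)
    case (Suc m)
    have "energy (r (Suc m)) \<le> (1 - \<alpha> / card I) * energy (r m)"
      unfolding r_Suc by (rule energy_contraction[OF r_centered])
    also have "\<dots> \<le> q * energy (r m)"
      using q(3) energy_nonneg by (rule mult_right_mono)
    also have "\<dots> \<le> q * (energy (r 0) * q ^ m)"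
      using Suc q(1) by (intro mult_left_mono) auto
    finally show ?case
      by (simp add: mult_ac)
  qed simp
  define d where "d m = correction (r m)" for m
  have d_sq: "square_integrable M (d m)" for m
    unfolding d_def by (rule square_integrable_correction[OF r_centered])
  have d_int: "integrable M (d m)" for m
    using d_sq by (rule square_integrable_integrable)
  have d_le: "expectation (\<lambda>x. (d m x)\<^sup>2) \<le> energy (r 0) * q ^ m" for m
    unfolding d_def using correction_square_le_energy[OF r_centered] energy_r by (rule order.trans)
  define g where "g x = (\<Sum>m. d m x)" for x
  have g_sq: "square_integrable M g"
    unfolding g_def[abs_def] by (rule square_integrable_suminf_geometric[OF d_sq d_le q(1,2)])
  define \<eta> where "\<eta> x = g x + c" for x
  have \<eta>_sq: "square_integrable M \<eta>"
    unfolding \<eta>_def[abs_def] by (intro square_integrable_add g_sq square_integrable_const)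
  have "AE x in M. real_cond_exp M (F k) \<eta> x = \<xi> k x" if k: "k \<in> I" for k
  proof -
    interpret finite_measure_subalgebra M "F k"
      by (rule finite_measure_subalgebra[OF k])
    show ?thesis
    proof (rule real_cond_exp_charact)
      fix A assume A: "A \<in> sets (F k)"
      then have A_M: "A \<in> events"
        using subalgebra_F[OF k] by (auto simp: subalgebra_def)
      have set_int: "set_integrable M A f" if "integrable M f" for f :: "'a \<Rightarrow> real"
        unfolding set_integrable_def using integrable_mult_indicator[OF A_M that] .
      have \<xi>_int: "integrable M (\<xi> k)"
        using sq[OF k] by (rule square_integrable_integrable)
      have residual: "(LINT x:A|M. r N k x) = (LINT x:A|M. \<xi> k x) - (LINT x:A|M. c) - (\<Sum>m<N. LINT x:A|M. d m x)" for N
      proof (induction N)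
        case 0
        show ?case
          using set_integral_diff(2)[OF set_int[OF \<xi>_int] set_int[of "\<lambda>x. c"]] by (simp add: r_def)
      next
        case (Suc N)
        have "(LINT x:A|M. r (Suc N) k x) = (LINT x:A|M. r N k x) - (LINT x:A|M. real_cond_exp M (F k) (d N) x)"
          unfolding r_Suc residual_step_def d_def[symmetric]
          by (intro set_integral_diff set_int square_integrable_integrable r_sq k real_cond_exp_int d_int)
        also have "(LINT x:A|M. real_cond_exp M (F k) (d N) x) = (LINT x:A|M. d N x)"
          using real_cond_exp_intA[OF d_int A] by simp
        finally show ?case
          by (simp add: Suc)
      qed
      have r_le: "expectation (\<lambda>x. (r m k x)\<^sup>2) \<le> energy (r 0) * q ^ m" for m
      proof -
        have "expectation (\<lambda>x. (r m k x)\<^sup>2) \<le> energy (r m)"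
          unfolding energy_def using k finite_index
          by (intro member_le_sum[where f = "\<lambda>k. expectation (\<lambda>x. (r m k x)\<^sup>2)"]) auto
        then show ?thesis
          using energy_r[of m] by linarith
      qed
      have "(\<lambda>N. LINT x:A|M. r N k x) \<longlonglongrightarrow> 0"
        using set_integral_sums_geometric[OF r_sq[OF k] r_le q(1,2) A_M]
        by (intro summable_LIMSEQ_zero sums_summable)
      moreover have "(\<lambda>N. LINT x:A|M. r N k x)
          \<longlonglongrightarrow> (LINT x:A|M. \<xi> k x) - (LINT x:A|M. c) - (LINT x:A|M. g x)"
        unfolding residual g_def
        using set_integral_sums_geometric[OF d_sq d_le q(1,2) A_M]
        by (intro tendsto_diff tendsto_const) (simp add: sums_def)
      ultimately have "(LINT x:A|M. \<xi> k x) - (LINT x:A|M. c) - (LINT x:A|M. g x) = 0"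
        by (rule LIMSEQ_unique[symmetric])
      moreover have "(LINT x:A|M. \<eta> x) = (LINT x:A|M. g x) + (LINT x:A|M. c)"
        unfolding \<eta>_def
        by (intro set_integral_add set_int square_integrable_integrable g_sq square_integrable_const)
      ultimately show "(LINT x:A|M. \<eta> x) = (LINT x:A|M. \<xi> k x)"
        by linarith
    qed (use \<eta>_sq sq meas k square_integrable_integrable in auto)
  qed
  with \<eta>_sq show ?thesis
    by blast
qed

end

section \<open>The inverse marginal property\<close>

theorem theorem5p5:
  fixes M :: "'a measure" and F :: "nat \<Rightarrow> 'a measure" and n :: nat
  assumes "prob_space M"
    and "n \<ge> 1"
    and "\<And>k. k \<in> {1..n} \<Longrightarrow> subalgebra M (F k)"
    and "\<exists>\<alpha>::real. \<alpha> > 0 \<and>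
           (\<forall>A :: nat \<Rightarrow> 'a set. (\<forall>k\<in>{1..n}. A k \<in> sets (F k)) \<longrightarrow>
              measure M (\<Inter>k\<in>{1..n}. A k) \<ge> \<alpha> * (\<Prod>k\<in>{1..n}. measure M (A k)))"
  shows "IMP_real M n F \<and> IMP_complex M n F"
proof -
  interpret prob_space M
    by fact
  obtain \<alpha> where \<alpha>: "\<alpha> > 0" "\<And>A :: nat \<Rightarrow> 'a set. (\<And>k. k \<in> {1..n} \<Longrightarrow> A k \<in> sets (F k)) \<Longrightarrow>
      measure M (\<Inter>k\<in>{1..n}. A k) \<ge> \<alpha> * (\<Prod>k\<in>{1..n}. measure M (A k))"
    using assms(4) by blast
  interpret quasi_independent M F "{1..n}" \<alpha>
    by unfold_locales (use assms(2,3) \<alpha> in auto)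
  have 1: "1 \<in> {1..n}"
    using assms(2) by simp
  have measurable_M: "f \<in> borel_measurable M" if "k \<in> {1..n}" "f \<in> borel_measurable (F k)"
    for k and f :: "'a \<Rightarrow> 'b::{banach, second_countable_topology}"
    using measurable_from_subalg[OF subalgebra_F] that by blast
  have "\<exists>\<eta>. \<eta> \<in> borel_measurable M \<and> integrable M (\<lambda>x. (norm (\<eta> x))\<^sup>2) \<and>
      (\<forall>k\<in>{1..n}. AE x in M. real_cond_exp M (F k) \<eta> x = \<xi> k x)"
    if \<xi>: "\<forall>k\<in>{1..n}. \<xi> k \<in> borel_measurable (F k) \<and> integrable M (\<lambda>x. (norm (\<xi> k x))\<^sup>2)"
      and mean: "\<forall>i\<in>{1..n}. \<forall>j\<in>{1..n}. expectation (\<xi> i) = expectation (\<xi> j)" for \<xi> :: "nat \<Rightarrow> 'a \<Rightarrow> real"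
  proof -
    have "\<exists>\<eta>. square_integrable M \<eta> \<and> (\<forall>k\<in>{1..n}. AE x in M. real_cond_exp M (F k) \<eta> x = \<xi> k x)"
    proof (rule ex_common_real_cond_exp)
      fix k assume k: "k \<in> {1..n}"
      show meas: "\<xi> k \<in> borel_measurable (F k)"
        using \<xi> k by blast
      show "square_integrable M (\<xi> k)"
        using measurable_M[OF k meas] bspec[OF \<xi> k] by (simp add: square_integrable_def)
      show "expectation (\<xi> k) = expectation (\<xi> 1)"
        using mean k 1 by blast
    qed
    then show ?thesis
      by (simp add: square_integrable_def conj_assoc)
  qed
  then have real: "IMP_real M n F"
    unfolding IMP_real_def imp_wrt_def by blast
  have "\<exists>\<eta>. \<eta> \<in> borel_measurable M \<and> integrable M (\<lambda>x. (norm (\<eta> x))\<^sup>2) \<and>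
      (\<forall>k\<in>{1..n}. AE x in M. complex_cond_exp M (F k) \<eta> x = \<xi> k x)"
    if \<xi>: "\<forall>k\<in>{1..n}. \<xi> k \<in> borel_measurable (F k) \<and> integrable M (\<lambda>x. (norm (\<xi> k x))\<^sup>2)"
      and mean: "\<forall>i\<in>{1..n}. \<forall>j\<in>{1..n}. expectation (\<xi> i) = expectation (\<xi> j)" for \<xi> :: "nat \<Rightarrow> 'a \<Rightarrow> complex"
  proof -
    have meas: "(\<lambda>x. Re (\<xi> k x)) \<in> borel_measurable (F k)" "(\<lambda>x. Im (\<xi> k x)) \<in> borel_measurable (F k)"
      if "k \<in> {1..n}" for k
      using bspec[OF \<xi> that] by (simp_all add: borel_measurable_complex_iff)
    have \<xi>_M: "\<xi> k \<in> borel_measurable M" if "k \<in> {1..n}" for k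
      using measurable_M[OF that] \<xi> that by blast
    have norm2: "square_integrable M (\<lambda>x. norm (\<xi> k x))" if "k \<in> {1..n}" for k
      using \<xi> \<xi>_M that by (simp add: square_integrable_def)
    have sq: "square_integrable M (\<lambda>x. Re (\<xi> k x))" "square_integrable M (\<lambda>x. Im (\<xi> k x))"
      if "k \<in> {1..n}" for k
      using \<xi>_M[OF that]
      by (intro square_integrable_bound[OF norm2[OF that]]; simp add: abs_Re_le_cmod abs_Im_le_cmod)+
    have \<xi>_int: "integrable M (\<xi> k)" if "k \<in> {1..n}" for k
      using square_integrable_integrable[OF norm2[OF that]] \<xi>_M[OF that]
      by (rule integrable_norm_cancel)
    have means: "expectation (\<lambda>x. Re (\<xi> k x)) = Re (expectation (\<xi> 1))"
        "expectation (\<lambda>x. Im (\<xi> k x)) = Im (expectation (\<xi> 1))" if "k \<in> {1..n}" for k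
    proof -
      have "expectation (\<xi> k) = expectation (\<xi> 1)"
        using mean 1 that by blast
      then show "expectation (\<lambda>x. Re (\<xi> k x)) = Re (expectation (\<xi> 1))"
        "expectation (\<lambda>x. Im (\<xi> k x)) = Im (expectation (\<xi> 1))"
        using \<xi>_int[OF that] by simp_all
    qed
    obtain u where u: "square_integrable M u" "\<forall>k\<in>{1..n}. AE x in M. real_cond_exp M (F k) u x = Re (\<xi> k x)"
      using ex_common_real_cond_exp[OF meas(1) sq(1) means(1)] by blast
    obtain v where v: "square_integrable M v" "\<forall>k\<in>{1..n}. AE x in M. real_cond_exp M (F k) v x = Im (\<xi> k x)"
      using ex_common_real_cond_exp[OF meas(2) sq(2) means(2)] by blast
    show ?thesis
    proof (intro exI conjI ballI)
      show "(\<lambda>x. Complex (u x) (v x)) \<in> borel_measurable M"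
        using u(1) v(1) by (simp add: square_integrable_def borel_measurable_complex_iff)
      show "integrable M (\<lambda>x. (norm (Complex (u x) (v x)))\<^sup>2)"
        using u(1) v(1) by (simp add: square_integrable_def cmod_power2)
      fix k assume k: "k \<in> {1..n}"
      show "AE x in M. complex_cond_exp M (F k) (\<lambda>x. Complex (u x) (v x)) x = \<xi> k x"
        using bspec[OF u(2) k] bspec[OF v(2) k]
        by eventually_elim (simp add: complex_cond_exp_def complex_eq_iff)
    qed
  qed
  then have "IMP_complex M n F"
    unfolding IMP_complex_def imp_wrt_def by blast
  with real show ?thesis
    by blast
qed

end
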